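(* Let $(X,\unlhd,\wedge,\vee,0,1)$ be a bounded trellis and $F$ a binary operation on $X$. The following statements hold: (i) If $F$ is a pseudo-t-norm on $X$ that is idempotent and satisfies $F(x\wedge y,x\wedge y)\unlhd F(x,y)$ for all $x,y\in X$, then $F$ is the meet operation $\wedge$ of $X$. (ii) If $F$ is a pseudo-t-conorm on $X$ that is idempotent and satisfies $F(x,y)\unlhd F(x\vee y,x\vee y)$ for all $x,y\in X$, then $F$ is the join operation $\vee$ of $X$.
   Context: A pseudo-order $\unlhd$ on a set $X$ is a reflexive and antisymmetric relation (not necessarily transitive); lower/upper bounds, infima and suprema are defined as for partially ordered sets (they are unique when they exist). A trellis $(X,\unlhd,\wedge,\vee)$ is a set with a pseudo-order in which any two elements $x,y$ have an infimum $x\wedge y$ and a supremum $x\vee y$. It is bounded, written $(X,\unlhd,\wedge,\vee,0,1)$, if it has elements $0,1$ with $0\unlhd x\unlhd 1$ for all $x\in X$. An element $\alpha\in X$ is right-transitive if $\alpha\unlhd x\unlhd y$ implies $\alpha\unlhd y$; left-transitive if $x\unlhd y\unlhd\alpha$ implies $x\unlhd\alpha$; middle-transitive if $x\unlhd\alpha\unlhd y$ implies $x\unlhd y$ (for all $x,y\in X$); transitive if all three hold. A triple $(x,y,z)$ is $\wedge$-associative if $(x\wedge y)\wedge z=x\wedge(y\wedge z)$, and $\vee$-associative if $(x\vee y)\vee z=x\vee(y\vee z)$. An element is $\wedge$-associative (resp. $\vee$-associative) if every triple in $X^3$ containing it is $\wedge$-associative (resp. $\vee$-associative). A binary operation $F$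 on $X$ is weakly-increasing if, whenever $x\unlhd y$ and at least one of $x,y$ is transitive, $F(x,z)\unlhd F(y,z)$ for all $z\in X$. It is weakly-associative if $F(x,F(y,z))=F(F(x,y),z)$ for all $x,y,z\in X$ such that at least one of $x,y,z$ is $\wedge$-associative or at least one of $x,y,z$ is $\vee$-associative. A pseudo-t-norm on $X$ is a commutative, weakly-increasing, weakly-associative binary operation $T$ with $T(1,x)=x$ for all $x\in X$; a pseudo-t-conorm is a commutative, weakly-increasing, weakly-associative binary operation $S$ with $S(0,x)=x$ for all $x\in X$. $F$ is idempotent if $F(x,x)=x$ for all $x\in X$. *)

theory Defs
  imports Main "HOL-Library.FuncSet"
begin

definition pseudo_order_on :: "'a set \<Rightarrow> ('a \<Rightarrow> 'a \<Rightarrow> bool) \<Rightarrow> bool" where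
  "pseudo_order_on X le \<longleftrightarrow> reflp_on X le \<and> antisymp_on X le"

definition is_lower_bound :: "'a set \<Rightarrow> ('a \<Rightarrow> 'a \<Rightarrow> bool) \<Rightarrow> 'a set \<Rightarrow> 'a \<Rightarrow> bool" where
  "is_lower_bound X le A m \<longleftrightarrow> m \<in> X \<and> (\<forall>a\<in>A. le m a)"

definition is_upper_bound :: "'a set \<Rightarrow> ('a \<Rightarrow> 'a \<Rightarrow> bool) \<Rightarrow> 'a set \<Rightarrow> 'a \<Rightarrow> bool" where
  "is_upper_bound X le A m \<longleftrightarrow> m \<in> X \<and> (\<forall>a\<in>A. le a m)"

definition is_infimum :: "'a set \<Rightarrow> ('a \<Rightarrow> 'a \<Rightarrow> bool) \<Rightarrow> 'a set \<Rightarrow> 'a \<Rightarrow> bool" where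
  "is_infimum X le A m \<longleftrightarrow>
     is_lower_bound X le A m \<and> (\<forall>l. is_lower_bound X le A l \<longrightarrow> le l m)"

definition is_supremum :: "'a set \<Rightarrow> ('a \<Rightarrow> 'a \<Rightarrow> bool) \<Rightarrow> 'a set \<Rightarrow> 'a \<Rightarrow> bool" where
  "is_supremum X le A m \<longleftrightarrow>
     is_upper_bound X le A m \<and> (\<forall>u. is_upper_bound X le A u \<longrightarrow> le m u)"

text \<open>The operations \<open>meet\<close> and \<open>join\<close> are part of the structure; by antisymmetry they are
  determined on \<open>X\<close> by the axioms below. Their values outside \<open>X\<close> are irrelevant.\<close>

locale trellis =
  fixes X :: "'a set" and le :: "'a \<Rightarrow> 'a \<Rightarrow> bool"
    and meet :: "'a \<Rightarrow> 'a \<Rightarrow> 'a" and join :: "'a \<Rightarrow> 'a \<Rightarrow> 'a"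
  assumes pseudo_order: "pseudo_order_on X le"
    and meet_infimum: "\<And>x y. x \<in> X \<Longrightarrow> y \<in> X \<Longrightarrow> is_infimum X le {x, y} (meet x y)"
    and join_supremum: "\<And>x y. x \<in> X \<Longrightarrow> y \<in> X \<Longrightarrow> is_supremum X le {x, y} (join x y)"

locale bounded_trellis = trellis X le meet join
  for X :: "'a set" and le meet join +
  fixes zero :: 'a and one :: 'a
  assumes zero_closed: "zero \<in> X"
    and one_closed: "one \<in> X"
    and zero_least: "\<And>x. x \<in> X \<Longrightarrow> le zero x"
    and one_greatest: "\<And>x. x \<in> X \<Longrightarrow> le x one"

definition right_transitive :: "'a set \<Rightarrow> ('a \<Rightarrow> 'a \<Rightarrow> bool) \<Rightarrow> 'a \<Rightarrow> bool" where
  "right_transitive X le a \<longleftrightarrow> (\<forall>x\<in>X. \<forall>y\<in>X. le a x \<and> le x y \<longrightarrow> le a y)"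

definition left_transitive :: "'a set \<Rightarrow> ('a \<Rightarrow> 'a \<Rightarrow> bool) \<Rightarrow> 'a \<Rightarrow> bool" where
  "left_transitive X le a \<longleftrightarrow> (\<forall>x\<in>X. \<forall>y\<in>X. le x y \<and> le y a \<longrightarrow> le x a)"

definition middle_transitive :: "'a set \<Rightarrow> ('a \<Rightarrow> 'a \<Rightarrow> bool) \<Rightarrow> 'a \<Rightarrow> bool" where
  "middle_transitive X le a \<longleftrightarrow> (\<forall>x\<in>X. \<forall>y\<in>X. le x a \<and> le a y \<longrightarrow> le x y)"

definition transitive_element :: "'a set \<Rightarrow> ('a \<Rightarrow> 'a \<Rightarrow> bool) \<Rightarrow> 'a \<Rightarrow> bool" where
  "transitive_element X le a \<longleftrightarrow>
     right_transitive X le a \<and> left_transitive X le a \<and> middle_transitive X le a"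

definition assoc_triple :: "('a \<Rightarrow> 'a \<Rightarrow> 'a) \<Rightarrow> 'a \<Rightarrow> 'a \<Rightarrow> 'a \<Rightarrow> bool" where
  "assoc_triple f x y z \<longleftrightarrow> f (f x y) z = f x (f y z)"

text \<open>With \<open>f\<close> the meet (join) of a trellis, this is meet-associativity (join-associativity)
  of an element.\<close>

definition assoc_element :: "'a set \<Rightarrow> ('a \<Rightarrow> 'a \<Rightarrow> 'a) \<Rightarrow> 'a \<Rightarrow> bool" where
  "assoc_element X f a \<longleftrightarrow>
     (\<forall>x\<in>X. \<forall>y\<in>X. \<forall>z\<in>X. a \<in> {x, y, z} \<longrightarrow> assoc_triple f x y z)"

definition weakly_increasing ::
  "'a set \<Rightarrow> ('a \<Rightarrow> 'a \<Rightarrow> bool) \<Rightarrow> ('a \<Rightarrow> 'a \<Rightarrow> 'a) \<Rightarrow> bool" where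
  "weakly_increasing X le F \<longleftrightarrow>
     (\<forall>x\<in>X. \<forall>y\<in>X. le x y \<and> (transitive_element X le x \<or> transitive_element X le y)
        \<longrightarrow> (\<forall>z\<in>X. le (F x z) (F y z)))"

definition weakly_associative ::
  "'a set \<Rightarrow> ('a \<Rightarrow> 'a \<Rightarrow> 'a) \<Rightarrow> ('a \<Rightarrow> 'a \<Rightarrow> 'a) \<Rightarrow> ('a \<Rightarrow> 'a \<Rightarrow> 'a) \<Rightarrow> bool" where
  "weakly_associative X meet join F \<longleftrightarrow>
     (\<forall>x\<in>X. \<forall>y\<in>X. \<forall>z\<in>X.
        (\<exists>a\<in>{x, y, z}. assoc_element X meet a) \<or> (\<exists>a\<in>{x, y, z}. assoc_element X join a)
        \<longrightarrow> F x (F y z) = F (F x y) z)"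

definition commutative_on :: "'a set \<Rightarrow> ('a \<Rightarrow> 'a \<Rightarrow> 'a) \<Rightarrow> bool" where
  "commutative_on X F \<longleftrightarrow> (\<forall>x\<in>X. \<forall>y\<in>X. F x y = F y x)"

definition idempotent_on :: "'a set \<Rightarrow> ('a \<Rightarrow> 'a \<Rightarrow> 'a) \<Rightarrow> bool" where
  "idempotent_on X F \<longleftrightarrow> (\<forall>x\<in>X. F x x = x)"

definition pseudo_t_norm ::
  "'a set \<Rightarrow> ('a \<Rightarrow> 'a \<Rightarrow> bool) \<Rightarrow> ('a \<Rightarrow> 'a \<Rightarrow> 'a) \<Rightarrow> ('a \<Rightarrow> 'a \<Rightarrow> 'a) \<Rightarrow> 'a
    \<Rightarrow> ('a \<Rightarrow> 'a \<Rightarrow> 'a) \<Rightarrow> bool" where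
  "pseudo_t_norm X le meet join one T \<longleftrightarrow>
     T \<in> X \<rightarrow> X \<rightarrow> X \<and> commutative_on X T \<and> weakly_increasing X le T
     \<and> weakly_associative X meet join T \<and> (\<forall>x\<in>X. T one x = x)"

definition pseudo_t_conorm ::
  "'a set \<Rightarrow> ('a \<Rightarrow> 'a \<Rightarrow> bool) \<Rightarrow> ('a \<Rightarrow> 'a \<Rightarrow> 'a) \<Rightarrow> ('a \<Rightarrow> 'a \<Rightarrow> 'a) \<Rightarrow> 'a
    \<Rightarrow> ('a \<Rightarrow> 'a \<Rightarrow> 'a) \<Rightarrow> bool" where
  "pseudo_t_conorm X le meet join zero S \<longleftrightarrow>
     S \<in> X \<rightarrow> X \<rightarrow> X \<and> commutative_on X S \<and> weakly_increasing X le S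
     \<and> weakly_associative X meet join S \<and> (\<forall>x\<in>X. S zero x = x)"

end

theory Submission imports Defs begin

text \<open>A pseudo-order need not be transitive, so weak monotonicity of \<open>F\<close> compares values only
  along pairs with a transitive member. One such pair is always available: the greatest element
  \<open>1\<close> is transitive, and \<open>x \<unlhd> 1\<close> gives \<open>F(x, y) \<unlhd> F(1, y) = y\<close>. With commutativity, \<open>F(x, y)\<close>
  is thus a lower bound of \<open>x\<close> and \<open>y\<close>, hence below \<open>x \<and> y\<close>. Conversely idempotency turns the
  extra hypothesis \<open>F(x \<and> y, x \<and> y) \<unlhd> F(x, y)\<close> into \<open>x \<and> y \<unlhd> F(x, y)\<close>, and antisymmetry
  finishes the first part. The second part is the first one read in the reversed
  pseudo-order: reversal exchanges meets with joins, \<open>1\<close> with \<open>0\<close>, and pseudo-t-norms with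
  pseudo-t-conorms.\<close>

text \<open>Transitivity of the top element is the point where antisymmetry replaces transitivity of
  the relation: anything above \<open>1\<close> is \<open>1\<close> itself, so all three conditions degenerate.\<close>

lemma (in bounded_trellis) transitive_element_one: "transitive_element X le one"
proof -
  have "le one x \<longleftrightarrow> x = one" if "x \<in> X" for x
    using that pseudo_order one_closed one_greatest
    by (auto simp: pseudo_order_on_def dest: antisymp_onD)
  then show ?thesis
    by (auto simp: transitive_element_def right_transitive_def left_transitive_def
        middle_transitive_def one_greatest)
qed

lemma (in bounded_trellis) pseudo_t_norm_le_right:
  assumes F: "pseudo_t_norm X le meet join one F" and "x \<in> X" "y \<in> X"
  shows "le (F x y) y"
proof -
  have "le (F x y) (F one y)"
    using F transitive_element_one one_greatest one_closed \<open>x \<in> X\<close> \<open>y \<in> X\<close>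
    unfolding pseudo_t_norm_def weakly_increasing_def by blast
  then show ?thesis
    using F \<open>y \<in> X\<close> by (simp add: pseudo_t_norm_def)
qed

lemma (in bounded_trellis) pseudo_t_norm_le_meet:
  assumes F: "pseudo_t_norm X le meet join one F" and xy: "x \<in> X" "y \<in> X"
  shows "le (F x y) (meet x y)"
proof -
  have "F x y \<in> X" and "F x y = F y x"
    using F xy by (auto simp: pseudo_t_norm_def commutative_on_def Pi_iff)
  then have "is_lower_bound X le {x, y} (F x y)"
    using pseudo_t_norm_le_right[OF F xy] pseudo_t_norm_le_right[OF F xy(2) xy(1)]
    by (simp add: is_lower_bound_def)
  then show ?thesis
    using meet_infimum[OF xy] by (simp add: is_infimum_def)
qed

theorem (in bounded_trellis) idempotent_pseudo_t_norm_eq_meet: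
  assumes F: "pseudo_t_norm X le meet join one F" and "idempotent_on X F"
    and ge: "\<And>x y. x \<in> X \<Longrightarrow> y \<in> X \<Longrightarrow> le (F (meet x y) (meet x y)) (F x y)"
    and xy: "x \<in> X" "y \<in> X"
  shows "F x y = meet x y"
proof -
  have closed: "F x y \<in> X" "meet x y \<in> X"
    using F meet_infimum[OF xy] xy
    by (auto simp: pseudo_t_norm_def Pi_iff is_infimum_def is_lower_bound_def)
  then have "le (meet x y) (F x y)"
    using ge[OF xy] \<open>idempotent_on X F\<close> by (simp add: idempotent_on_def)
  with pseudo_t_norm_le_meet[OF F xy] closed show ?thesis
    using pseudo_order by (auto simp: pseudo_order_on_def dest: antisymp_onD)
qed

lemma is_infimum_dual: "is_infimum X (\<lambda>x y. le y x) A m \<longleftrightarrow> is_supremum X le A m"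
  unfolding is_infimum_def is_supremum_def is_lower_bound_def is_upper_bound_def ..

lemma is_supremum_dual: "is_supremum X (\<lambda>x y. le y x) A m \<longleftrightarrow> is_infimum X le A m"
  unfolding is_infimum_def is_supremum_def is_lower_bound_def is_upper_bound_def ..

lemma (in bounded_trellis) dual_bounded_trellis:
  "bounded_trellis X (\<lambda>x y. le y x) join meet one zero"
proof unfold_locales
  show "is_infimum X (\<lambda>x y. le y x) {x, y} (join x y)" if "x \<in> X" "y \<in> X" for x y
    using join_supremum[OF that] by (simp only: is_infimum_dual)
  show "is_supremum X (\<lambda>x y. le y x) {x, y} (meet x y)" if "x \<in> X" "y \<in> X" for x y
    using meet_infimum[OF that] by (simp only: is_supremum_dual)
  show "pseudo_order_on X (\<lambda>x y. le y x)"
    using pseudo_order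
    by (auto simp: pseudo_order_on_def reflp_on_def antisymp_on_def)
qed (fact zero_closed one_closed zero_least one_greatest)+

lemma transitive_element_dual:
  "transitive_element X (\<lambda>x y. le y x) a \<longleftrightarrow> transitive_element X le a"
  unfolding transitive_element_def right_transitive_def left_transitive_def
    middle_transitive_def
  by blast

text \<open>A pseudo-t-conorm is a pseudo-t-norm of the reversed order. This works because transitivity
  of an element is self-dual and weak associativity treats meet and join symmetrically.\<close>

lemma pseudo_t_norm_dual:
  "pseudo_t_norm X (\<lambda>x y. le y x) join meet zero F \<longleftrightarrow> pseudo_t_conorm X le meet join zero F"
proof -
  have "weakly_increasing X (\<lambda>x y. le y x) F \<longleftrightarrow> weakly_increasing X le F"
    unfolding weakly_increasing_def transitive_element_dual[of X le] by blast
  moreover have "weakly_associative X join meet F \<longleftrightarrow> weakly_associative X meet join F"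
    unfolding weakly_associative_def by (intro ball_cong refl, subst disj_commute) (rule refl)
  ultimately show ?thesis
    by (simp add: pseudo_t_norm_def pseudo_t_conorm_def)
qed

theorem proposition3p13:
  fixes X :: "'a set" and le :: "'a \<Rightarrow> 'a \<Rightarrow> bool"
    and meet join F :: "'a \<Rightarrow> 'a \<Rightarrow> 'a" and zero one :: 'a
  assumes "bounded_trellis X le meet join zero one"
    and "F \<in> X \<rightarrow> X \<rightarrow> X"
  shows "(pseudo_t_norm X le meet join one F \<and> idempotent_on X F
            \<and> (\<forall>x\<in>X. \<forall>y\<in>X. le (F (meet x y) (meet x y)) (F x y))
          \<longrightarrow> (\<forall>x\<in>X. \<forall>y\<in>X. F x y = meet x y))
       \<and> (pseudo_t_conorm X le meet join zero F \<and> idempotent_on X F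
            \<and> (\<forall>x\<in>X. \<forall>y\<in>X. le (F x y) (F (join x y) (join x y)))
          \<longrightarrow> (\<forall>x\<in>X. \<forall>y\<in>X. F x y = join x y))"
proof -
  interpret bounded_trellis X le meet join zero one by fact
  interpret dual: bounded_trellis X "\<lambda>x y. le y x" join meet one zero
    by (rule dual_bounded_trellis)
  show ?thesis
  proof (intro conjI impI ballI; elim conjE)
    fix x y assume "x \<in> X" "y \<in> X" "pseudo_t_norm X le meet join one F" "idempotent_on X F"
      and "\<forall>x\<in>X. \<forall>y\<in>X. le (F (meet x y) (meet x y)) (F x y)"
    then show "F x y = meet x y"
      by (intro idempotent_pseudo_t_norm_eq_meet) simp_all
  next
    fix x y assume "x \<in> X" "y \<in> X" "pseudo_t_conorm X le meet join zero F" "idempotent_on X F"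
      and "\<forall>x\<in>X. \<forall>y\<in>X. le (F x y) (F (join x y) (join x y))"
    then show "F x y = join x y"
      by (intro dual.idempotent_pseudo_t_norm_eq_meet) (simp_all only: pseudo_t_norm_dual)
  qed
qed

end
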